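(* Let $B$ be an unbounded non-negative self-adjoint operator in $\mathcal{H}$ with $\ker B=\{0\}$ and $\operatorname{ran}B\neq\mathcal{H}$. Then there exist two linear manifolds $\mathfrak{D}_1,\mathfrak{D}_2\subset\operatorname{dom}B$ such that (1) $\mathfrak{D}_1+\mathfrak{D}_2=\operatorname{dom}B$; (2) $B\mathfrak{D}_1$ and $B\mathfrak{D}_2$ are dense in $\mathcal{H}$. Moreover, $\mathfrak{D}_1,\mathfrak{D}_2$ can be chosen such that $\mathfrak{D}_1\cap\mathfrak{D}_2=\{0\}$ and $\mathfrak{D}_1\perp\mathfrak{D}_2$ with respect to the graph inner product $(f,g)_B:=(Bf,Bg)+(f,g)$, so that $\operatorname{dom}B=\mathfrak{D}_1\oplus_B\mathfrak{D}_2$.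
   Context: $\mathcal{H}$ is a complex, infinite-dimensional, separable Hilbert space; $\oplus_B$ denotes an orthogonal direct sum with respect to the graph inner product $(\cdot,\cdot)_B$. *)

theory Defs
  imports "HOL-Analysis.Analysis"
begin

text \<open>HOL-Analysis only provides real inner product spaces. A complex Hilbert space
is encoded as a real Hilbert space together with the (real-linear, isometric)
operator of multiplication by the imaginary unit, whose square is minus the
identity. Complex scalar multiplication and the complex inner product
(antilinear in the first argument, linear in the second) are then defined.\<close>

class complex_hilbert = real_inner + complete_space +
  fixes imult :: "'a \<Rightarrow> 'a"
  assumes imult_add: "imult (x + y) = imult x + imult y"
    and imult_scaleR: "imult (r *\<^sub>R x) = r *\<^sub>R imult x"
    and imult_imult: "imult (imult x) = - x"
    and inner_imult: "inner (imult x) (imult y) = inner x y"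

definition scaleC :: "complex \<Rightarrow> 'a::complex_hilbert \<Rightarrow> 'a" where
  "scaleC c x = Re c *\<^sub>R x + Im c *\<^sub>R imult x"

definition cinner :: "'a::complex_hilbert \<Rightarrow> 'a \<Rightarrow> complex" where
  "cinner x y = complex_of_real (inner x y) + \<i> * complex_of_real (inner (imult x) y)"

definition csubspace :: "'a::complex_hilbert set \<Rightarrow> bool" where
  "csubspace S \<longleftrightarrow> 0 \<in> S \<and> (\<forall>x\<in>S. \<forall>y\<in>S. x + y \<in> S) \<and> (\<forall>c. \<forall>x\<in>S. scaleC c x \<in> S)"

text \<open>An operator is a pair (domain D, map B); values of B outside D are irrelevant.\<close>
definition clinear_on :: "'a::complex_hilbert set \<Rightarrow> ('a \<Rightarrow> 'a) \<Rightarrow> bool" where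
  "clinear_on D B \<longleftrightarrow> (\<forall>x\<in>D. \<forall>y\<in>D. B (x + y) = B x + B y) \<and>
                       (\<forall>c. \<forall>x\<in>D. B (scaleC c x) = scaleC c (B x))"

definition adj_dom :: "'a::complex_hilbert set \<Rightarrow> ('a \<Rightarrow> 'a) \<Rightarrow> 'a set" where
  "adj_dom D B = {g. \<exists>h. \<forall>f\<in>D. cinner (B f) g = cinner f h}"

definition self_adjoint_op :: "'a::complex_hilbert set \<Rightarrow> ('a \<Rightarrow> 'a) \<Rightarrow> bool" where
  "self_adjoint_op D B \<longleftrightarrow> csubspace D \<and> closure D = UNIV \<and> clinear_on D B \<and>
     adj_dom D B = D \<and> (\<forall>f\<in>D. \<forall>g\<in>D. cinner (B f) g = cinner f (B g))"

end

theory Submission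
  imports Defs
begin

text \<open>View the graph of \<open>B\<close> as a closed complex subspace \<open>K\<close> of the
product space, whose inner product is the graph inner product, and let \<open>A\<close> be the
projection to the second component, so that \<open>A ` K = ran B\<close> is dense but not
everything. If \<open>V\<close> is a closed complex subspace with \<open>A ` V\<close> dense and
\<open>g \<in> V\<close> is not in the range of the adjoint of \<open>A\<close> restricted to
\<open>V\<close>, then the orthogonal complement of \<open>g\<close> in \<open>V\<close> still has
dense image. By uniform boundedness such \<open>g\<close> exist, and adding a small multiple of one
to an arbitrary vector shows that \<open>A g\<close> can be placed close to any given point.
Iterating gives an orthogonal sequence in \<open>K\<close> whose images approximate every point of a
countable dense set by members of two disjoint classes of indices. The orthogonal complement of the
first class and the orthogonal complement of that are the required subspaces.\<close>

section \<open>Orthogonal projection and density in real Hilbert spaces\<close>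

text \<open>By the parallelogram law a sequence in \<open>S\<close> minimizing the distance to
  \<open>x\<close> is Cauchy. Its limit \<open>p\<close> is a minimizer, and moving \<open>p\<close>
  along \<open>y\<close> cannot decrease the distance only if the residual is orthogonal to
  \<open>y\<close>.\<close>

lemma exists_orthogonal_projection:
  fixes S :: "'a::{real_inner,complete_space} set"
  assumes S: "subspace S" "closed S"
  obtains p where "p \<in> S" "\<And>y. y \<in> S \<Longrightarrow> inner (x - p) y = 0"
proof -
  define q where "q y = (norm (x - y))\<^sup>2" for y
  define m where "m = Inf (q ` S)"
  have "0 \<in> S" using S by (simp add: subspace_0)
  have bdd: "bdd_below (q ` S)"
    by (rule bdd_belowI[of _ 0]) (auto simp: q_def)
  have m_le: "m \<le> q y" if "y \<in> S" for y
    unfolding m_def using that bdd by (auto intro: cInf_lower)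
  have "\<exists>y\<in>S. q y < m + inverse (real (Suc n))" for n
  proof -
    have "Inf (q ` S) < m + inverse (real (Suc n))" by (simp add: m_def)
    then show ?thesis
      using cInf_lessD[of "q ` S"] \<open>0 \<in> S\<close> by blast
  qed
  then obtain Y where Y: "\<And>n. Y n \<in> S" "\<And>n. q (Y n) < m + inverse (real (Suc n))"
    by metis
  have par: "(norm (y - z))\<^sup>2 \<le> 2 * (q y - m) + 2 * (q z - m)" if "y \<in> S" "z \<in> S" for y z
  proof -
    have "(1/2) *\<^sub>R (y + z) \<in> S"
      using S that by (simp add: subspace_add subspace_scale)
    then have "m \<le> q ((1/2) *\<^sub>R (y + z))" by (rule m_le)
    moreover have "(norm (y - z))\<^sup>2 = 2 * q y + 2 * q z - 4 * q ((1/2) *\<^sub>R (y + z))"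
      unfolding q_def power2_norm_eq_inner
      by (simp add: inner_simps inner_commute field_simps)
    ultimately show ?thesis by simp
  qed
  have "Cauchy Y"
  proof (rule metric_CauchyI)
    fix e :: real assume "e > 0"
    \<comment> \<open>In \<open>par\<close> each of the two excesses over \<open>m\<close> is
      counted twice, so a quarter of the squared tolerance for each suffices.\<close>
    then obtain N where N: "inverse (real (Suc N)) < e\<^sup>2 / 4"
      using reals_Archimedean[of "e\<^sup>2/4"] by auto
    show "\<exists>M. \<forall>i\<ge>M. \<forall>n\<ge>M. dist (Y i) (Y n) < e"
    proof (intro exI allI impI)
      fix i n assume "N \<le> i" "N \<le> n"
      then have "inverse (real (Suc i)) \<le> inverse (real (Suc N))" "inverse (real (Suc n)) \<le> inverse (real (Suc N))"
        by (simp_all add: le_imp_inverse_le)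
      then have "q (Y i) < m + e\<^sup>2 / 4" "q (Y n) < m + e\<^sup>2 / 4"
        using Y(2)[of i] Y(2)[of n] N by linarith+
      then have "(norm (Y i - Y n))\<^sup>2 < e\<^sup>2"
        using par[OF Y(1)[of i] Y(1)[of n]] by argo
      then show "dist (Y i) (Y n) < e"
        using \<open>e > 0\<close> by (simp add: dist_norm power_less_imp_less_base)
    qed
  qed
  then obtain p where p: "Y \<longlonglongrightarrow> p"
    using Cauchy_convergent_iff convergent_def by blast
  have "p \<in> S"
    using S(2) Y(1) p closed_sequentially by blast
  have "(\<lambda>n. q (Y n)) \<longlonglongrightarrow> q p"
    unfolding q_def by (intro tendsto_intros p)
  moreover have "(\<lambda>n. m + inverse (real (Suc n))) \<longlonglongrightarrow> m + 0"
    by (intro tendsto_intros LIMSEQ_inverse_real_of_nat)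
  ultimately have "q p \<le> m + 0"
    using Y(2) by (intro LIMSEQ_le) (auto intro!: less_imp_le)
  then have min: "q p \<le> q y" if "y \<in> S" for y
    using m_le[OF that] by simp
  have "inner (x - p) y = 0" if "y \<in> S" for y
  proof (cases "y = 0")
    case False
    \<comment> \<open>This \<open>t\<close> minimizes the quadratic t ->
      \<open>q (p + t *\<^sub>R y)\<close>.\<close>
    define t where "t = inner (x - p) y / inner y y"
    have "p + t *\<^sub>R y \<in> S"
      using S(1) \<open>p \<in> S\<close> that by (simp add: subspace_add subspace_scale)
    then have "q p \<le> q (p + t *\<^sub>R y)" by (rule min)
    also have "q (p + t *\<^sub>R y) = q p - 2 * t * inner (x - p) y + t * t * inner y y"
      unfolding q_def power2_norm_eq_inner by (simp add: inner_simps inner_commute algebra_simps)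
    also have "\<dots> = q p - (inner (x - p) y)\<^sup>2 / inner y y"
      using False by (simp add: t_def power2_eq_square)
    finally have "(inner (x - p) y)\<^sup>2 / inner y y \<le> 0" by simp
    moreover have "inner y y > 0" using False by simp
    ultimately show ?thesis by (simp add: divide_le_0_iff)
  qed simp
  with \<open>p \<in> S\<close> show thesis by (rule that)
qed

lemma subspace_closure:
  fixes S :: "'a::real_normed_vector set"
  assumes "subspace S"
  shows "subspace (closure S)"
  unfolding subspace_def
proof (intro conjI ballI allI)
  show "0 \<in> closure S"
    using assms closure_subset subspace_0 by blast
next
  fix x y assume "x \<in> closure S" "y \<in> closure S"
  then obtain X Y where "\<And>n. X n \<in> S" "\<And>n. Y n \<in> S" "X \<longlonglongrightarrow> x" "Y \<longlonglongrightarrow> y"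
    by (auto simp: closure_sequential)
  then show "x + y \<in> closure S"
    unfolding closure_sequential using assms tendsto_add subspace_add
    by (intro exI[of _ "\<lambda>n. X n + Y n"]) blast
next
  fix c :: real and x assume "x \<in> closure S"
  then obtain X where "\<And>n. X n \<in> S" "X \<longlonglongrightarrow> x"
    by (auto simp: closure_sequential)
  then show "c *\<^sub>R x \<in> closure S"
    unfolding closure_sequential using assms subspace_scale
    by (intro exI[of _ "\<lambda>n. c *\<^sub>R X n"]) (auto intro: tendsto_intros)
qed

text \<open>The residual of the projection onto \<open>closure S\<close> is orthogonal to
  \<open>S\<close>, so it vanishes if only 0 is. All later density claims except
  \<open>approx\<close> are reduced to this test.\<close>

lemma closure_eq_UNIV_iff_orthogonal:
  fixes S :: "'a::{real_inner,complete_space} set"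
  assumes "subspace S"
  shows "closure S = UNIV \<longleftrightarrow> (\<forall>h. (\<forall>s\<in>S. inner s h = 0) \<longrightarrow> h = 0)"
proof
  assume dense: "closure S = UNIV"
  show "\<forall>h. (\<forall>s\<in>S. inner s h = 0) \<longrightarrow> h = 0"
  proof (intro allI impI)
    fix h assume h: "\<forall>s\<in>S. inner s h = 0"
    have "closed {s. inner s h = 0}"
      by (intro closed_Collect_eq continuous_intros)
    then have "closure S \<subseteq> {s. inner s h = 0}"
      using h by (intro closure_minimal) auto
    then have "inner h h = 0" using dense by blast
    then show "h = 0" by simp
  qed
next
  assume orth: "\<forall>h. (\<forall>s\<in>S. inner s h = 0) \<longrightarrow> h = 0"
  have "x \<in> closure S" for x
  proof -
    obtain p where p: "p \<in> closure S" "\<And>y. y \<in> closure S \<Longrightarrow> inner (x - p) y = 0"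
      using exists_orthogonal_projection assms closed_closure subspace_closure by metis
    then have "\<forall>s\<in>S. inner s (x - p) = 0"
      using closure_subset by (metis inner_commute subsetD)
    then show ?thesis using orth p(1) by fastforce
  qed
  then show "closure S = UNIV" by blast
qed

section \<open>Uniform boundedness and the range of the adjoint\<close>

text \<open>Pointwise boundedness says that the closed sets \<open>E n\<close> cover the space, so
  by Baire one of them contains a ball. Comparing its centre with a boundary point in the direction
  of \<open>x\<close> bounds \<open>norm x\<close>.\<close>

lemma uniform_boundedness_inner:
  fixes X :: "'a::{real_inner,complete_space} set"
  assumes ptw: "\<And>v. \<exists>c. \<forall>x\<in>X. \<bar>inner v x\<bar> \<le> c"
  obtains c where "\<And>x. x \<in> X \<Longrightarrow> norm x \<le> c"
proof -
  define E where "E n = {v. \<forall>x\<in>X. \<bar>inner v x\<bar> \<le> real n}" for n :: nat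
  have E: "closed (E n)" for n
    unfolding E_def Ball_def by (intro closed_Collect_all closed_Collect_imp closed_Collect_le continuous_intros) auto
  have "v \<in> \<Union>(range E)" for v
  proof -
    obtain c where "\<forall>x\<in>X. \<bar>inner v x\<bar> \<le> c" using ptw by blast
    moreover obtain n where "c \<le> real n" using real_arch_simple by blast
    ultimately have "v \<in> E n" unfolding E_def by force
    then show ?thesis by blast
  qed
  then have "\<Union>(range E) = UNIV" by blast
  then have "interior (\<Union>(range E)) \<noteq> {}" by simp
  then obtain n where n: "interior (E n) \<noteq> {}"
    using Baire_category_alt[of "euclidean :: 'a topology" "range E"] E completely_metrizable_space_euclidean
    by auto
  then obtain v where "v \<in> interior (E n)" by blast
  then obtain e where e: "e > 0" "cball v e \<subseteq> E n"
    by (meson mem_interior_cball)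
  have "norm x \<le> 2 * real n / e" if "x \<in> X" for x
  proof (cases "x = 0")
    case False
    define w where "w = (e / norm x) *\<^sub>R x"
    have "v \<in> E n" "v + w \<in> E n"
      using e False by (auto simp: w_def dist_norm subset_eq)
    then have "\<bar>inner v x\<bar> \<le> real n" "\<bar>inner (v + w) x\<bar> \<le> real n"
      using that by (auto simp: E_def)
    then have "inner w x \<le> 2 * real n" by (simp add: inner_add_left)
    moreover have "inner w x = e * norm x"
      using False by (simp add: w_def power2_norm_eq_inner[symmetric] power2_eq_square)
    ultimately show ?thesis using e by (simp add: field_simps)
  qed (use e in simp)
  then show thesis by (rule that)
qed

text \<open>The condition on \<open>u\<close> says that it is not in the range of the adjoint of \<open>A\<close> restricted to \<open>V\<close>;
stated this way, neither the adjoint nor the Riesz theorem is needed.\<close>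

lemma not_onto_imp_adjoint_not_onto:
  fixes A :: "'a::{real_inner,complete_space} \<Rightarrow> 'b::{real_inner,complete_space}"
  assumes A: "bounded_linear A" and V: "subspace V" "closed V"
    and dense: "closure (A ` V) = UNIV" and not_onto: "A ` V \<noteq> UNIV"
  obtains u where "u \<in> V" "\<nexists>h. \<forall>v\<in>V. inner (A v) h = inner v u"
proof (rule ccontr)
  assume "\<not> thesis"
  with that have adj: "\<exists>h. \<forall>v\<in>V. inner (A v) h = inner v u" if "u \<in> V" for u
    using \<open>u \<in> V\<close> by blast
  interpret A: bounded_linear A by (rule A)
  \<comment> \<open>If every \<open>u\<close> were attained, \<open>X\<close> would be weakly
    bounded, hence bounded. Then \<open>A\<close> is bounded below on \<open>V\<close>, so its image
    is complete and closed, and a dense closed image is everything.\<close>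
  define X where "X = {v \<in> V. norm (A v) \<le> 1}"
  have "\<exists>c. \<forall>v\<in>X. \<bar>inner w v\<bar> \<le> c" for w
  proof -
    \<comment> \<open>On \<open>V\<close> the functional given by \<open>w\<close> agrees with the
      one given by its projection \<open>p\<close>, to which \<open>adj\<close> applies.\<close>
    obtain p where p: "p \<in> V" "\<And>y. y \<in> V \<Longrightarrow> inner (w - p) y = 0"
      using exists_orthogonal_projection V by blast
    obtain h where h: "\<forall>v\<in>V. inner (A v) h = inner v p"
      using adj p(1) by blast
    have "\<bar>inner w v\<bar> \<le> norm h" if "v \<in> X" for v
    proof -
      have "inner w v = inner (A v) h"
        using p(2)[of v] h that by (simp add: X_def inner_diff_left inner_commute[of p])
      also have "\<bar>\<dots>\<bar> \<le> norm (A v) * norm h" by (rule Cauchy_Schwarz_ineq2)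
      also have "\<dots> \<le> 1 * norm h"
        using that by (intro mult_right_mono) (auto simp: X_def)
      finally show ?thesis by simp
    qed
    then show ?thesis by blast
  qed
  then obtain c where c: "\<And>v. v \<in> X \<Longrightarrow> norm v \<le> c"
    using uniform_boundedness_inner by blast
  define C where "C = max c 1"
  have C: "norm v \<le> C" if "v \<in> X" for v using c[OF that] by (simp add: C_def)
  have "C > 0" by (simp add: C_def)
  have bdd: "norm v \<le> C * norm (A v)" if v: "v \<in> V" for v
  proof (cases "A v = 0")
    case True
    have "norm v = 0"
    proof (rule ccontr)
      assume "norm v \<noteq> 0"
      \<comment> \<open>This multiple has image 0 but norm \<open>C + 1\<close>, beyond the bound on
        \<open>X\<close>.\<close>
      have "((C + 1) / norm v) *\<^sub>R v \<in> X"
        using v V True by (simp add: X_def subspace_scale A.scaleR)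
      from C[OF this] \<open>norm v \<noteq> 0\<close> \<open>C > 0\<close> show False by simp
    qed
    then show ?thesis using True by simp
  next
    case False
    then have "(1 / norm (A v)) *\<^sub>R v \<in> X"
      using v V by (simp add: X_def subspace_scale A.scaleR)
    from C[OF this] False show ?thesis by (simp add: field_simps)
  qed
  have "complete (A ` V)"
  proof (rule complete_isometric_image)
    show "0 < 1 / C" using \<open>C > 0\<close> by simp
    show "\<forall>x\<in>V. norm (A x) \<ge> 1 / C * norm x"
      using bdd \<open>C > 0\<close> by (simp add: field_simps)
  qed (use V A in \<open>auto simp: complete_eq_closed\<close>)
  then have "closed (A ` V)" by (rule complete_imp_closed)
  with dense not_onto show False by simp
qed

section \<open>Complex subspaces and cutting off one direction\<close>

lemma csubspace_iff: "csubspace S \<longleftrightarrow> subspace S \<and> imult ` S \<subseteq> S"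
proof
  assume S: "csubspace S"
  have "c *\<^sub>R x \<in> S" if "x \<in> S" for c x
    using S that by (auto simp: csubspace_def scaleC_def dest!: spec[of _ "complex_of_real c"])
  moreover have "imult x \<in> S" if "x \<in> S" for x
    using S that by (auto simp: csubspace_def scaleC_def dest!: spec[of _ \<i>])
  ultimately show "subspace S \<and> imult ` S \<subseteq> S"
    using S by (auto simp: csubspace_def subspace_def)
next
  assume "subspace S \<and> imult ` S \<subseteq> S"
  then show "csubspace S"
    by (auto simp: csubspace_def scaleC_def subspace_def)
qed

lemma inner_imult_left: "inner (imult x) y = - inner x (imult y)"
  using inner_imult[of x "imult y"] by (simp add: imult_imult)

lemma inner_imult_self [simp]: "inner (imult x) x = 0" "inner x (imult x) = 0"
  using inner_imult_left[of x x] by (simp_all add: inner_commute)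

text \<open>If \<open>h\<close> is orthogonal to the image of the cut subspace, the functional v ->
  \<open>inner (A v) h\<close> on \<open>V\<close> vanishes on that subspace, so it is represented
  by a complex multiple of \<open>g\<close>. For \<open>g\<close> outside \<open>R\<close> this
  multiple must be 0, and density of the image of \<open>V\<close> gives \<open>h = 0\<close>. The
  conditions on \<open>g\<close> and \<open>imult g\<close> together express complex
  orthogonality.\<close>

lemma exists_good_direction:
  fixes A :: "'a::complex_hilbert \<Rightarrow> 'b::complex_hilbert"
  assumes A: "bounded_linear A" "\<And>x. A (imult x) = imult (A x)"
    and V: "csubspace V" "closed V"
    and dense: "closure (A ` V) = UNIV" and not_onto: "A ` V \<noteq> UNIV"
    and "e > 0"
  obtains g where "g \<in> V" "dist (A g) y < e"
    "closure (A ` {v \<in> V. inner v g = 0 \<and> inner v (imult g) = 0}) = UNIV"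
proof -
  interpret A: bounded_linear A by (rule A)
  have imV: "imult v \<in> V" if "v \<in> V" for v
    using V(1) that by (auto simp: csubspace_iff)
  have sub: "subspace V" using V(1) by (simp add: csubspace_iff)
  define R where "R = {u \<in> V. \<exists>h. \<forall>v\<in>V. inner (A v) h = inner v u}"
  obtain u where u: "u \<in> V" "u \<notin> R"
    using not_onto_imp_adjoint_not_onto[OF A(1) sub V(2) dense not_onto] unfolding R_def by blast
  have "y \<in> closure (A ` V)" using dense by simp
  then obtain g0 where g0: "g0 \<in> V" "dist (A g0) y < e"
    using \<open>e > 0\<close> by (auto simp: closure_approachable)
  obtain g where g: "g \<in> V" "dist (A g) y < e" "g \<notin> R"
  proof (cases "g0 \<in> R")
    case True
    \<comment> \<open>The slack left by \<open>g0\<close> is \<open>d * (1 + norm (A u))\<close>;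
      the summand 1 keeps the denominator positive and the final inequality strict. As
      \<open>R\<close> is closed under real linear combinations, adding a nonzero multiple of
      \<open>u\<close> leaves it.\<close>
    define d where "d = (e - dist (A g0) y) / (1 + norm (A u))"
    have pos: "1 + norm (A u) > 0" by (simp add: add_pos_nonneg)
    then have "d > 0" using g0 by (simp add: d_def)
    have "dist (A (g0 + d *\<^sub>R u)) y \<le> dist (A g0) y + d * norm (A u)"
      using \<open>d > 0\<close> norm_triangle_ineq[of "A g0 - y" "d *\<^sub>R A u"]
      by (simp add: dist_norm A.add A.scaleR algebra_simps)
    also have "\<dots> < dist (A g0) y + d * (1 + norm (A u))"
      using \<open>d > 0\<close> by simp
    also have "\<dots> = e" using pos by (simp add: d_def)
    finally have "dist (A (g0 + d *\<^sub>R u)) y < e" .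
    moreover have "g0 + d *\<^sub>R u \<notin> R"
    proof
      assume "g0 + d *\<^sub>R u \<in> R"
      then obtain h where h: "\<forall>v\<in>V. inner (A v) h = inner v (g0 + d *\<^sub>R u)"
        unfolding R_def by blast
      obtain h0 where h0: "\<forall>v\<in>V. inner (A v) h0 = inner v g0"
        using True unfolding R_def by blast
      have "\<forall>v\<in>V. inner (A v) ((1 / d) *\<^sub>R (h - h0)) = inner v u"
        using h h0 \<open>d > 0\<close> by (simp add: inner_simps)
      with u show False unfolding R_def by blast
    qed
    moreover have "g0 + d *\<^sub>R u \<in> V"
      using sub g0 u by (simp add: subspace_add subspace_scale)
    ultimately show thesis using that by blast
  qed (use g0 that in blast)
  define W where "W = {v \<in> V. inner v g = 0 \<and> inner v (imult g) = 0}"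
  have "g \<noteq> 0"
  proof
    assume "g = 0"
    then have "\<forall>v\<in>V. inner (A v) 0 = inner v g" by simp
    with g show False unfolding R_def by blast
  qed
  have "subspace W"
    using sub by (auto simp: W_def subspace_def inner_simps)
  then have "subspace (A ` W)"
    using A.linear by (simp add: linear_subspace_image)
  moreover have "h = 0" if h: "\<forall>s\<in>A ` W. inner s h = 0" for h
  proof -
    \<comment> \<open>The adjoint maps \<open>h\<close> to the complex multiple \<open>(a + b i) g\<close>; dividing by \<open>a + b i\<close> would put \<open>g\<close> in \<open>R\<close>.\<close>
    define a where "a = inner (A g) h / inner g g"
    define b where "b = inner (A (imult g)) h / inner g g"
    have rep: "inner (A v) h = a * inner v g + b * inner v (imult g)" if "v \<in> V" for v
    proof -
      \<comment> \<open>\<open>g\<close> and \<open>imult g\<close> are orthogonal and of equal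
        norm, so subtracting these two components projects \<open>v\<close> onto
        \<open>W\<close>.\<close>
      let ?w = "v - (inner v g / inner g g) *\<^sub>R g - (inner v (imult g) / inner g g) *\<^sub>R imult g"
      have "?w \<in> W"
        using sub that g imV \<open>g \<noteq> 0\<close>
        by (simp add: W_def subspace_diff subspace_scale inner_diff_left inner_imult)
      then have "inner (A ?w) h = 0" using h by blast
      then show ?thesis
        by (simp add: A.diff A.scaleR inner_diff_left a_def b_def mult.commute)
    qed
    \<comment> \<open>This is \<open>rep\<close> at \<open>imult v\<close>: the other real component
      of the same complex identity.\<close>
    have repi: "inner (A v) (imult h) = a * inner v (imult g) - b * inner v g" if "v \<in> V" for v
    proof -
      have "inner (A v) (imult h) = - inner (A (imult v)) h"
        by (simp add: A(2) inner_imult_left)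
      also have "\<dots> = - (a * inner (imult v) g + b * inner (imult v) (imult g))"
        using rep imV that by simp
      finally show ?thesis by (simp add: inner_imult_left inner_imult imult_imult)
    qed
    have ab: "a\<^sup>2 + b\<^sup>2 = 0"
    proof (rule ccontr)
      assume nz: "a\<^sup>2 + b\<^sup>2 \<noteq> 0"
      \<comment> \<open>The witness is \<open>h\<close> divided by the complex number a + b i,
        written as multiplication by the conjugate over the squared modulus.\<close>
      have "inner (A v) ((1 / (a\<^sup>2 + b\<^sup>2)) *\<^sub>R (a *\<^sub>R h - b *\<^sub>R imult h)) = inner v g" if "v \<in> V" for v
      proof -
        have "inner (A v) (a *\<^sub>R h - b *\<^sub>R imult h) = (a\<^sup>2 + b\<^sup>2) * inner v g"
          by (simp add: inner_simps rep repi that power2_eq_square algebra_simps)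
        then show ?thesis using nz by simp
      qed
      with g show False unfolding R_def by blast
    qed
    then have "a = 0" "b = 0" by (simp_all add: sum_power2_eq_zero_iff)
    then have "\<forall>s\<in>A ` V. inner s h = 0" using rep by auto
    then show "h = 0"
      using dense closure_eq_UNIV_iff_orthogonal[of "A ` V"] sub A.linear by (simp add: linear_subspace_image)
  qed
  ultimately have "closure (A ` W) = UNIV"
    using closure_eq_UNIV_iff_orthogonal by blast
  with g show thesis using that unfolding W_def by blast
qed

text \<open>Allowing a set \<open>G\<close> covers both the cut by one vector and the complement of
  a whole family. Moving \<open>imult\<close> across the inner product exchanges the two conditions
  up to sign.\<close>

lemma orthogonal_pair_constraint:
  assumes V: "csubspace V" "closed V"
  shows "csubspace {v \<in> V. \<forall>g\<in>G. inner v g = 0 \<and> inner v (imult g) = 0}" (is "csubspace ?W")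
    and "closed {v \<in> V. \<forall>g\<in>G. inner v g = 0 \<and> inner v (imult g) = 0}"
proof -
  have "subspace ?W"
    using V by (auto simp: csubspace_iff subspace_def inner_simps)
  moreover have "imult ` ?W \<subseteq> ?W"
    using V by (auto simp: csubspace_iff inner_imult_left imult_imult)
  ultimately show "csubspace ?W" by (simp add: csubspace_iff)
  have "closed {v. \<forall>g\<in>G. inner v g = 0 \<and> inner v (imult g) = 0}"
    unfolding Ball_def
    by (intro closed_Collect_all closed_Collect_imp closed_Collect_conj closed_Collect_eq continuous_intros) auto
  then have "closed (V \<inter> {v. \<forall>g\<in>G. inner v g = 0 \<and> inner v (imult g) = 0})"
    using V(2) by (rule closed_Int[rotated])
  then show "closed ?W" by (simp only: Int_def mem_Collect_eq)
qed

section \<open>Orthogonal sequences and the splitting\<close>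

text \<open>Choose \<open>g n\<close> in the current subspace by
  \<open>exists_good_direction\<close> and pass to its complement there. The image stays dense, and
  it stays proper because the subspace lies in \<open>K\<close>, so the choice can be
  repeated.\<close>

lemma exists_orthogonal_approximating_sequence:
  fixes A :: "'a::complex_hilbert \<Rightarrow> 'b::complex_hilbert"
  assumes A: "bounded_linear A" "\<And>x. A (imult x) = imult (A x)"
    and K: "csubspace K" "closed K"
    and dense: "closure (A ` K) = UNIV" and not_onto: "A ` K \<noteq> UNIV"
    and e: "\<And>n. e n > 0"
  obtains g :: "nat \<Rightarrow> 'a" where "\<And>n. g n \<in> K" "\<And>n. dist (A (g n)) (y n) < e n"
    "\<And>m n. m \<noteq> n \<Longrightarrow> inner (g m) (g n) = 0 \<and> inner (g m) (imult (g n)) = 0"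
proof -
  define good where "good V \<longleftrightarrow> csubspace V \<and> closed V \<and> V \<subseteq> K \<and> closure (A ` V) = UNIV" for V
  define cut where "cut V g = {v \<in> V. inner v g = 0 \<and> inner v (imult g) = 0}" for V and g :: 'a
  have "\<exists>W. good W \<and> (\<exists>g\<in>V. dist (A g) (y n) < e n \<and> W = cut V g)" if "good V" for V n
  proof -
    have V: "csubspace V" "closed V" "V \<subseteq> K" "closure (A ` V) = UNIV"
      using that by (auto simp: good_def)
    then have "A ` V \<noteq> UNIV" using not_onto by blast
    then obtain g where g: "g \<in> V" "dist (A g) (y n) < e n" "closure (A ` cut V g) = UNIV"
      unfolding cut_def using exists_good_direction[OF A V(1,2,4) _ e] by blast
    have "csubspace (cut V g)" "closed (cut V g)"
      using orthogonal_pair_constraint[OF V(1,2), of "{g}"] by (simp_all add: cut_def)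
    with g V(3) have "good (cut V g)" by (auto simp: good_def cut_def)
    with g show ?thesis by blast
  qed
  moreover have "good K" using K dense by (simp add: good_def)
  ultimately obtain V where V: "\<And>n. good (V n)"
    "\<And>n. \<exists>g\<in>V n. dist (A g) (y n) < e n \<and> V (Suc n) = cut (V n) g"
    using dependent_nat_choice[of "\<lambda>_. good" "\<lambda>n V W. \<exists>g\<in>V. dist (A g) (y n) < e n \<and> W = cut V g"]
    by metis
  then obtain g where g: "\<And>n. g n \<in> V n" "\<And>n. dist (A (g n)) (y n) < e n"
    "\<And>n. V (Suc n) = cut (V n) (g n)"
    by metis
  have "V (Suc n) \<subseteq> V n" for n using g(3) by (auto simp: cut_def)
  then have anti: "V n \<subseteq> V m" if "m \<le> n" for m n
    using that by (rule lift_Suc_antimono_le)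
  \<comment> \<open>\<open>g n\<close> lies in \<open>V (Suc m)\<close>, which was cut by
    \<open>g m\<close>.\<close>
  have less: "inner (g n) (g m) = 0 \<and> inner (g n) (imult (g m)) = 0" if "m < n" for m n
    using g(1)[of n] anti[of "Suc m" n] that g(3)[of m] by (auto simp: cut_def)
  have "inner (g m) (g n) = 0 \<and> inner (g m) (imult (g n)) = 0" if "m \<noteq> n" for m n
  proof (cases "n < m")
    case False
    then have "m < n" using that by simp
    from less[OF this] show ?thesis
      using inner_imult_left[of "g n" "g m"] by (simp add: inner_commute)
  qed (use less in blast)
  moreover have "g n \<in> K" for n
    using g(1) V(1) by (auto simp: good_def)
  ultimately show thesis using that g(2) by blast
qed

lemma exists_orthogonal_splitting_dense_images:
  fixes A :: "'a::complex_hilbert \<Rightarrow> 'b::complex_hilbert"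
  assumes A: "bounded_linear A" "\<And>x. A (imult x) = imult (A x)"
    and K: "csubspace K" "closed K"
    and dense: "closure (A ` K) = UNIV" and not_onto: "A ` K \<noteq> UNIV"
    and sep: "\<exists>C::'b set. countable C \<and> closure C = UNIV"
  obtains S1 S2 where "csubspace S1" "csubspace S2" "S1 \<subseteq> K" "S2 \<subseteq> K"
    "\<And>k. k \<in> K \<Longrightarrow> \<exists>x\<in>S1. \<exists>y\<in>S2. k = x + y"
    "\<And>x y. x \<in> S1 \<Longrightarrow> y \<in> S2 \<Longrightarrow> inner x y = 0"
    "closure (A ` S1) = UNIV" "closure (A ` S2) = UNIV"
proof -
  obtain C :: "'b set" where C: "countable C" "closure C = UNIV" using sep by blast
  then have "C \<noteq> {}" by auto
  \<comment> \<open>A triple \<open>(c, k, b)\<close> requests a vector of class \<open>b\<close> whose image is within \<open>1 / (k + 1)\<close> of \<open>c\<close>.\<close>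
  define s where "s = from_nat_into (C \<times> (UNIV :: nat set) \<times> (UNIV :: bool set))"
  have s: "range s = C \<times> UNIV \<times> UNIV"
    unfolding s_def using C \<open>C \<noteq> {}\<close> by (intro range_from_nat_into) auto
  obtain g where g: "\<And>n. g n \<in> K"
    "\<And>n. dist (A (g n)) (fst (s n)) < inverse (real (Suc (fst (snd (s n)))))"
    "\<And>m n. m \<noteq> n \<Longrightarrow> inner (g m) (g n) = 0 \<and> inner (g m) (imult (g n)) = 0"
    using exists_orthogonal_approximating_sequence[OF A K dense not_onto,
        of "\<lambda>n. inverse (real (Suc (fst (snd (s n)))))" "\<lambda>n. fst (s n)"]
    by auto
  define T where "T b = {n. snd (snd (s n)) = b}" for b
  \<comment> \<open>Containing all vectors of one class is enough for a dense image, whatever else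
    \<open>S\<close> contains.\<close>
  have approx: "closure (A ` S) = UNIV" if S: "g ` T b \<subseteq> S" for S b
  proof -
    have "C \<subseteq> closure (A ` S)"
    proof
      fix c assume "c \<in> C"
      show "c \<in> closure (A ` S)"
        unfolding closure_approachable
      proof (intro allI impI)
        fix e :: real assume "e > 0"
        then obtain k where k: "inverse (real (Suc k)) < e" using reals_Archimedean by blast
        have "(c, k, b) \<in> range s" using \<open>c \<in> C\<close> by (simp add: s)
        then obtain n where n: "s n = (c, k, b)" by force
        then have "g n \<in> S" using S by (auto simp: T_def)
        moreover have "dist (A (g n)) c < e" using g(2)[of n] n k by simp
        ultimately show "\<exists>y\<in>A ` S. dist y c < e" by blast
      qed
    qed
    then have "closure C \<subseteq> closure (A ` S)" by (simp add: closure_minimal)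
    with C(2) show ?thesis by blast
  qed
  \<comment> \<open>Using a complement and its complement, rather than closed spans, makes both sets
    complex subspaces by \<open>orthogonal_pair_constraint\<close>, and closedness of
    \<open>S2\<close> provides the projection that splits \<open>K\<close>.\<close>
  define S2 where "S2 = {v \<in> K. \<forall>x\<in>g ` T True. inner v x = 0 \<and> inner v (imult x) = 0}"
  define S1 where "S1 = {v \<in> K. \<forall>x\<in>S2. inner v x = 0 \<and> inner v (imult x) = 0}"
  have S2: "csubspace S2" "closed S2" and S1: "csubspace S1"
    unfolding S1_def S2_def by (intro orthogonal_pair_constraint K)+
  have subS2: "subspace S2" and imS2: "\<And>x. x \<in> S2 \<Longrightarrow> imult x \<in> S2"
    using S2 by (auto simp: csubspace_iff)
  have subK: "subspace K" using K by (simp add: csubspace_iff)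
  show thesis
  proof (rule that[OF S1 S2(1)])
    show "S1 \<subseteq> K" "S2 \<subseteq> K" by (auto simp: S1_def S2_def)
    show "inner x y = 0" if "x \<in> S1" "y \<in> S2" for x y
      using that by (simp add: S1_def)
    show "\<exists>x\<in>S1. \<exists>y\<in>S2. k = x + y" if "k \<in> K" for k
    proof -
      obtain p where p: "p \<in> S2" "\<And>y. y \<in> S2 \<Longrightarrow> inner (k - p) y = 0"
        using exists_orthogonal_projection[OF subS2 S2(2)] by blast
      have "p \<in> K" using p(1) by (simp add: S2_def)
      \<comment> \<open>The projection gives only real orthogonality; closure of \<open>S2\<close>
        under \<open>imult\<close> supplies the other condition.\<close>
      with that have "k - p \<in> S1"
        using p(2) imS2 subK by (simp add: S1_def subspace_diff)
      with p(1) show ?thesis by (metis diff_add_cancel)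
    qed
    have "g n \<in> S2" if "n \<in> T False" for n
      using that g(1) g(3)[of n] by (force simp: S2_def T_def)
    then show "closure (A ` S2) = UNIV" by (intro approx) blast
    have "g n \<in> S1" if "n \<in> T True" for n
      using that g(1) by (simp add: S1_def S2_def inner_commute inner_imult_left)
    then show "closure (A ` S1) = UNIV" by (intro approx) blast
  qed
qed

section \<open>The graph of a self-adjoint operator\<close>

text \<open>The inner product of pairs is the sum over the components, so on pairs
  \<open>(f, B f)\<close> it is the real part of the graph inner product.\<close>

instantiation prod :: (complex_hilbert, complex_hilbert) complex_hilbert
begin

definition "imult x = (imult (fst x), imult (snd x))"

instance
proof
  fix x y :: "'a \<times> 'b" and r :: real
  show "imult (x + y) = imult x + imult y" "imult (r *\<^sub>R x) = r *\<^sub>R imult x"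
    by (simp_all add: imult_prod_def imult_add imult_scaleR)
  show "imult (imult x) = - x"
    by (simp add: imult_prod_def imult_imult uminus_prod_def)
  show "inner (imult x) (imult y) = inner x y"
    by (simp add: imult_prod_def inner_prod_def inner_imult)
qed

end

lemma cinner_eq_iff_inner:
  "cinner x y = cinner z w \<longleftrightarrow> inner x y = inner z w \<and> inner (imult x) y = inner (imult z) w"
  by (auto simp: cinner_def complex_eq_iff)

context
  fixes D :: "'a::complex_hilbert set" and B :: "'a \<Rightarrow> 'a"
  assumes sa: "self_adjoint_op D B"
begin

lemma self_adjoint_op_subspace: "subspace D" "\<And>x. x \<in> D \<Longrightarrow> imult x \<in> D"
  using sa by (auto simp: self_adjoint_op_def csubspace_iff)

lemma self_adjoint_op_linear:
  assumes "x \<in> D"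
  shows "y \<in> D \<Longrightarrow> B (x + y) = B x + B y" "B (c *\<^sub>R x) = c *\<^sub>R B x" "B (imult x) = imult (B x)"
proof -
  have lin: "B (scaleC c x) = scaleC c (B x)" for c
    using sa assms by (auto simp: self_adjoint_op_def clinear_on_def)
  show "B (c *\<^sub>R x) = c *\<^sub>R B x" "B (imult x) = imult (B x)"
    using lin[of "complex_of_real c"] lin[of \<i>] by (simp_all add: scaleC_def)
  show "y \<in> D \<Longrightarrow> B (x + y) = B x + B y"
    using sa assms by (auto simp: self_adjoint_op_def clinear_on_def)
qed

text \<open>Testing the hypothesis at \<open>imult f\<close> as well upgrades it to the complex
  identity, so \<open>g\<close> is in the adjoint domain, which is \<open>D\<close>. Symmetry and
  density of \<open>D\<close> then determine \<open>B g\<close>.\<close>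

lemma self_adjoint_op_domI:
  assumes h: "\<And>f. f \<in> D \<Longrightarrow> inner (B f) g = inner f h"
  shows "g \<in> D" "B g = h"
proof -
  have "cinner (B f) g = cinner f h" if "f \<in> D" for f
    using h[OF that] h[OF self_adjoint_op_subspace(2)[OF that]]
    by (simp add: cinner_eq_iff_inner self_adjoint_op_linear(3) that)
  then have "g \<in> adj_dom D B" unfolding adj_dom_def by blast
  then show "g \<in> D" using sa by (simp add: self_adjoint_op_def)
  then have "inner (B f) g = inner f (B g)" if "f \<in> D" for f
    using sa that by (simp add: self_adjoint_op_def cinner_eq_iff_inner)
  then have "\<forall>f\<in>D. inner f (B g - h) = 0"
    using h by (simp add: inner_diff_right)
  moreover have "closure D = UNIV" using sa by (simp add: self_adjoint_op_def)
  ultimately have "B g - h = 0"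
    using closure_eq_UNIV_iff_orthogonal[OF self_adjoint_op_subspace(1)] by blast
  then show "B g = h" by simp
qed

lemma self_adjoint_op_symmetric:
  "f \<in> D \<Longrightarrow> g \<in> D \<Longrightarrow> inner (B f) g = inner f (B g)"
  using sa by (simp add: self_adjoint_op_def cinner_eq_iff_inner)

lemma csubspace_graph: "csubspace ((\<lambda>f. (f, B f)) ` D)"
proof -
  have "(0, 0) \<in> (\<lambda>f. (f, B f)) ` D"
    using self_adjoint_op_linear(2)[of 0 0] subspace_0[OF self_adjoint_op_subspace(1)]
    by (force simp: image_iff)
  then have "subspace ((\<lambda>f. (f, B f)) ` D)"
    using self_adjoint_op_subspace(1) self_adjoint_op_linear
    by (auto simp: subspace_def zero_prod_def image_iff)
  then show ?thesis
    using self_adjoint_op_subspace(2) self_adjoint_op_linear(3)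
    by (auto simp: csubspace_iff imult_prod_def)
qed

text \<open>By \<open>self_adjoint_op_domI\<close> and symmetry the graph is the solution set of a
  family of equations continuous in \<open>p\<close>.\<close>

lemma closed_graph: "closed ((\<lambda>f. (f, B f)) ` D)"
proof -
  have "(\<lambda>f. (f, B f)) ` D = {p. \<forall>f. f \<in> D \<longrightarrow> inner (B f) (fst p) = inner f (snd p)}" (is "_ = ?R")
  proof (intro equalityI subsetI)
    fix p assume "p \<in> ?R"
    then have "fst p \<in> D" "B (fst p) = snd p" using self_adjoint_op_domI by simp_all
    then show "p \<in> (\<lambda>f. (f, B f)) ` D" by (intro image_eqI[of _ _ "fst p"]) (auto intro: prod_eqI)
  qed (auto simp: self_adjoint_op_symmetric)
  also have "closed \<dots>"
    by (intro closed_Collect_all closed_Collect_imp closed_Collect_eq continuous_intros) auto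
  finally show ?thesis .
qed

text \<open>A vector orthogonal to the range satisfies the hypothesis of
  \<open>self_adjoint_op_domI\<close> with value 0, so it lies in the kernel.\<close>

lemma dense_range_if_injective:
  assumes ker: "\<forall>f\<in>D. B f = 0 \<longrightarrow> f = 0"
  shows "closure (B ` D) = UNIV"
proof -
  have "B ` D = snd ` (\<lambda>f. (f, B f)) ` D" by (simp add: image_image)
  then have "subspace (B ` D)"
    using csubspace_graph by (metis csubspace_iff linear_snd linear_subspace_image)
  moreover have "h = 0" if "\<forall>s\<in>B ` D. inner s h = 0" for h
    using that ker self_adjoint_op_domI[of h 0] by simp
  ultimately show ?thesis using closure_eq_UNIV_iff_orthogonal by blast
qed

end

section \<open>Transfer of the splitting from the graph to the domain\<close>

theorem theorem3p28:
  fixes D :: "'a::complex_hilbert set" and B :: "'a \<Rightarrow> 'a"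
  assumes separable: "\<exists>C::'a set. countable C \<and> closure C = UNIV"
    and infinite_dim: "\<not> (\<exists>S::'a set. finite S \<and> span S = UNIV)"
    and selfadj: "self_adjoint_op D B"
    and nonneg: "\<forall>f\<in>D. 0 \<le> Re (cinner (B f) f)"
    and unbounded: "\<not> (\<exists>K. \<forall>f\<in>D. norm (B f) \<le> K * norm f)"
    and ker: "\<forall>f\<in>D. B f = 0 \<longrightarrow> f = 0"
    and ran: "B ` D \<noteq> UNIV"
  shows "\<exists>D1 D2. csubspace D1 \<and> csubspace D2 \<and> D1 \<subseteq> D \<and> D2 \<subseteq> D \<and>
           {x + y | x y. x \<in> D1 \<and> y \<in> D2} = D \<and>
           closure (B ` D1) = UNIV \<and> closure (B ` D2) = UNIV \<and>
           D1 \<inter> D2 = {0} \<and>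
           (\<forall>f\<in>D1. \<forall>g\<in>D2. cinner (B f) (B g) + cinner f g = 0)"
proof -
  define K where "K = (\<lambda>f. (f, B f)) ` D"
  have sndK: "snd ` K = B ` D" by (simp add: K_def image_image)
  have imult_snd: "snd (imult x) = imult (snd x)" for x :: "'a \<times> 'a"
    by (simp add: imult_prod_def)
  obtain S1 S2 where S: "csubspace S1" "csubspace S2" "S1 \<subseteq> K" "S2 \<subseteq> K"
    "\<And>k. k \<in> K \<Longrightarrow> \<exists>x\<in>S1. \<exists>y\<in>S2. k = x + y"
    "\<And>x y. x \<in> S1 \<Longrightarrow> y \<in> S2 \<Longrightarrow> inner x y = 0"
    "closure (snd ` S1) = UNIV" "closure (snd ` S2) = UNIV"
  proof (rule exists_orthogonal_splitting_dense_images[OF bounded_linear_snd imult_snd])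
    show "csubspace K" "closed K"
      unfolding K_def using selfadj by (rule csubspace_graph, rule closed_graph)
    show "closure (snd ` K) = UNIV" "snd ` K \<noteq> UNIV"
      using dense_range_if_injective[OF selfadj ker] ran by (simp_all add: sndK)
  qed (use separable in blast)+
  have cs_fst: "csubspace (fst ` S)" if "csubspace S" for S :: "('a \<times> 'a) set"
    using that linear_subspace_image[OF linear_fst]
    by (force simp: csubspace_iff imult_prod_def)
  have mem: "f \<in> D \<and> (f, B f) \<in> S" if "S \<subseteq> K" "f \<in> fst ` S" for S f
    using that by (auto simp: K_def)
  have im: "B ` fst ` S = snd ` S" if "S \<subseteq> K" for S
    using that by (force simp: K_def image_iff)
  have orth: "inner (B f) (B g) + inner f g = 0" if "f \<in> fst ` S1" "g \<in> fst ` S2" for f g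
    using S(6)[of "(f, B f)" "(g, B g)"] mem[OF S(3) that(1)] mem[OF S(4) that(2)]
    by (simp add: inner_prod_def)
  show ?thesis
  proof (intro exI conjI ballI)
    show "csubspace (fst ` S1)" "csubspace (fst ` S2)" using S cs_fst by auto
    show sub: "fst ` S1 \<subseteq> D" "fst ` S2 \<subseteq> D" using S(3,4) by (auto simp: K_def)
    show "{x + y | x y. x \<in> fst ` S1 \<and> y \<in> fst ` S2} = D"
    proof (intro equalityI subsetI)
      fix z assume "z \<in> {x + y | x y. x \<in> fst ` S1 \<and> y \<in> fst ` S2}"
      then show "z \<in> D"
        using sub self_adjoint_op_subspace(1)[OF selfadj] by (auto intro!: subspace_add)
    next
      fix z assume "z \<in> D"
      then have "(z, B z) \<in> K" by (simp add: K_def)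
      then obtain x y where "x \<in> S1" "y \<in> S2" "(z, B z) = x + y" using S(5) by blast
      then have "z = fst x + fst y" by (metis fst_add fst_conv)
      with \<open>x \<in> S1\<close> \<open>y \<in> S2\<close> show "z \<in> {x + y | x y. x \<in> fst ` S1 \<and> y \<in> fst ` S2}"
        by blast
    qed
    show "closure (B ` fst ` S1) = UNIV" "closure (B ` fst ` S2) = UNIV"
      using S(3,4,7,8) by (simp_all add: im)
    have "f = 0" if "f \<in> fst ` S1" "f \<in> fst ` S2" for f
    proof -
      \<comment> \<open>A common vector is orthogonal to itself in the graph inner product.\<close>
      have "inner (B f) (B f) + inner f f = 0" using orth that by blast
      then show "f = 0"
        by (metis add_nonneg_eq_0_iff inner_eq_zero_iff inner_ge_zero)
    qed
    moreover have "0 \<in> fst ` S1" "0 \<in> fst ` S2"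
      using cs_fst S(1,2) by (auto simp: csubspace_def)
    ultimately show "fst ` S1 \<inter> fst ` S2 = {0}" by blast
    fix f g assume fg: "f \<in> fst ` S1" "g \<in> fst ` S2"
    \<comment> \<open>Real orthogonality of \<open>imult f\<close> and \<open>g\<close> is the
      vanishing of the imaginary part.\<close>
    then have "imult f \<in> fst ` S1" using cs_fst[OF S(1)] by (auto simp: csubspace_iff)
    moreover have "f \<in> D" using fg sub by blast
    ultimately have "inner (imult (B f)) (B g) + inner (imult f) g = 0"
      using orth[of "imult f" g] fg self_adjoint_op_linear(3)[OF selfadj] by simp
    with orth[OF fg] show "cinner (B f) (B g) + cinner f g = 0"
      by (simp add: cinner_def complex_eq_iff)
  qed
qed

end
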